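(* Let $n\ge 4$ and let $A=A(x)$ be an $n$-by-$n$ partial reciprocal matrix in which every entry is specified except the $(1,n)$ entry $x$ and the $(n,1)$ entry $1/x$; for $x_0>0$ let $A(x_0)$ denote the (reciprocal) matrix obtained by setting $x=x_0$. Let $MT(A)$ be the maximum $3$-cycle product $a_{ij}a_{jk}a_{ki}$ over all triples of distinct indices none of whose pairs is $\{1,n\}$, and for a full reciprocal matrix $B=[b_{ij}]$ let $MT(B)=\max\{b_{ij}b_{jk}b_{ki}: i,j,k \text{ distinct}\}$. Let $M_S(A)=\max_{2\le j\le n-1}a_{1j}a_{jn}$ and $m_S(A)=\min_{2\le j\le n-1}a_{1j}a_{jn}$. Then, for $x_0>0$, $MT(A(x_0))=MT(A)$ if and only if $$\frac{1}{MT(A)}\,M_S(A)\le x_0\le MT(A)\,m_S(A).$$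
   Context: A partial reciprocal matrix has diagonal entries $1$, symmetric pattern of specified entries, and specified entries positive with $a_{ji}=1/a_{ij}$ whenever $a_{ij}$ is specified. A reciprocal matrix is an entrywise positive matrix with $b_{ji}=1/b_{ij}$. *)

theory Defs
  imports "Jordan_Normal_Form.Matrix"
begin

text \<open>
  Matrices are indexed from 0, so the mathematical indices \<open>1, \<dots>, n\<close> become \<open>0, \<dots>, n - 1\<close>.
  In a partial matrix, \<open>None\<close> marks an unspecified entry.
\<close>

definition reciprocal_mat :: "nat \<Rightarrow> real mat \<Rightarrow> bool" where
  "reciprocal_mat n B \<longleftrightarrow> B \<in> carrier_mat n n \<and>
     (\<forall>i<n. \<forall>j<n. B $$ (i, j) > 0 \<and> B $$ (j, i) = 1 / B $$ (i, j))"

definition partial_reciprocal_mat :: "nat \<Rightarrow> real option mat \<Rightarrow> bool" where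
  "partial_reciprocal_mat n A \<longleftrightarrow> A \<in> carrier_mat n n \<and>
     (\<forall>i<n. A $$ (i, i) = Some 1) \<and>
     (\<forall>i<n. \<forall>j<n. \<forall>a. A $$ (i, j) = Some a \<longrightarrow> a > 0 \<and> A $$ (j, i) = Some (1 / a))"

definition only_corners_unspecified :: "nat \<Rightarrow> 'a option mat \<Rightarrow> bool" where
  "only_corners_unspecified n A \<longleftrightarrow>
     (\<forall>i<n. \<forall>j<n. A $$ (i, j) = None \<longleftrightarrow> (i, j) = (0, n - 1) \<or> (i, j) = (n - 1, 0))"

text \<open>The matrix \<open>A(x)\<close>.\<close>

definition corner_completion :: "nat \<Rightarrow> real option mat \<Rightarrow> real \<Rightarrow> real mat" where
  "corner_completion n A x = mat n n (\<lambda>(i, j).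
     if (i, j) = (0, n - 1) then x
     else if (i, j) = (n - 1, 0) then 1 / x
     else the (A $$ (i, j)))"

definition MT :: "nat \<Rightarrow> real mat \<Rightarrow> real" where
  "MT n B = Max {B $$ (i, j) * B $$ (j, k) * B $$ (k, i) | i j k.
     i < n \<and> j < n \<and> k < n \<and> distinct [i, j, k]}"

definition MT_partial :: "nat \<Rightarrow> real option mat \<Rightarrow> real" where
  "MT_partial n A = Max {the (A $$ (i, j)) * the (A $$ (j, k)) * the (A $$ (k, i)) | i j k.
     i < n \<and> j < n \<and> k < n \<and> distinct [i, j, k] \<and> {0, n - 1} \<notin> {{i, j}, {j, k}, {k, i}}}"

definition MaxS :: "nat \<Rightarrow> real option mat \<Rightarrow> real" where
  "MaxS n A = Max {the (A $$ (0, j)) * the (A $$ (j, n - 1)) | j. 0 < j \<and> j < n - 1}"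

definition MinS :: "nat \<Rightarrow> real option mat \<Rightarrow> real" where
  "MinS n A = Min {the (A $$ (0, j)) * the (A $$ (j, n - 1)) | j. 0 < j \<and> j < n - 1}"

lemma reciprocal_corner_completion:
  assumes n: "n \<ge> 2" and A: "partial_reciprocal_mat n A" "only_corners_unspecified n A"
    and x: "x > 0"
  shows "reciprocal_mat n (corner_completion n A x)"
proof -
  let ?B = "corner_completion n A x"
  have entry: "?B $$ (i, j) = (if i = 0 \<and> j = n - 1 then x
      else if i = n - 1 \<and> j = 0 then 1 / x else the (A $$ (i, j)))" if "i < n" "j < n" for i j
    using that by (simp add: corner_completion_def)
  have ne: "n - 1 \<noteq> 0" using n by simp
  have "?B $$ (i, j) > 0 \<and> ?B $$ (j, i) = 1 / ?B $$ (i, j)" if ij: "i < n" "j < n" for i j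
  proof -
    consider "i = 0 \<and> j = n - 1" | "i = n - 1 \<and> j = 0"
      | "\<not> (i = 0 \<and> j = n - 1)" "\<not> (i = n - 1 \<and> j = 0)" by blast
    then show ?thesis
    proof cases
      case 1
      then show ?thesis unfolding entry[OF ij] entry[OF ij(2,1)] using ne x by simp
    next
      case 2
      then show ?thesis unfolding entry[OF ij] entry[OF ij(2,1)] using ne x by simp
    next
      case 3
      then have "A $$ (i, j) \<noteq> None"
        using A(2) ij unfolding only_corners_unspecified_def by blast
      then obtain a where a: "A $$ (i, j) = Some a" by blast
      then have "a > 0" "A $$ (j, i) = Some (1 / a)"
        using A(1) ij unfolding partial_reciprocal_mat_def by blast+
      moreover have "?B $$ (i, j) = the (A $$ (i, j))" "?B $$ (j, i) = the (A $$ (j, i))"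
        unfolding entry[OF ij] entry[OF ij(2,1)] using 3 by metis+
      ultimately show ?thesis using a by simp
    qed
  qed
  moreover have "?B \<in> carrier_mat n n" by (simp add: corner_completion_def)
  ultimately show ?thesis unfolding reciprocal_mat_def by blast
qed

end

theory Submission
  imports Defs
begin

text \<open>
  Completing the corner adds only the 3-cycles through the pair \<open>{1, n}\<close>. With
  \<open>s\<^sub>j = a\<^sub>1\<^sub>j a\<^sub>j\<^sub>n\<close>, their products are \<open>s\<^sub>j / x\<^sub>0\<close> and, in the opposite direction, \<open>x\<^sub>0 / s\<^sub>j\<close>.
  Hence the maximum is unchanged iff all of these are at most \<open>MT(A)\<close>, that is,
  \<open>s\<^sub>j \<le> MT(A) x\<^sub>0\<close> and \<open>x\<^sub>0 \<le> MT(A) s\<^sub>j\<close> for all \<open>j\<close>.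
\<close>

text \<open>\<open>Max S\<close> is itself an element of \<open>T\<close>, so as soon as it bounds
  \<open>T\<close> it is the maximum of \<open>T\<close>. This turns equality of the two maximal
  cycle products into a family of inequalities.\<close>

lemma Max_superset_eq_iff:
  fixes S T :: "'a :: linorder set"
  assumes "finite T" "S \<subseteq> T" "S \<noteq> {}"
  shows "Max T = Max S \<longleftrightarrow> (\<forall>t\<in>T. t \<le> Max S)"
proof
  assume "Max T = Max S"
  then show "\<forall>t\<in>T. t \<le> Max S"
    using assms(1) by (metis Max_ge)
next
  assume "\<forall>t\<in>T. t \<le> Max S"
  moreover have "Max S \<in> T"
    using assms by (meson Max_in finite_subset subsetD)
  ultimately show "Max T = Max S"
    using assms(1) by (intro Max_eqI) auto
qed

definition cycle3 :: "'a :: times mat \<Rightarrow> nat \<Rightarrow> nat \<Rightarrow> nat \<Rightarrow> 'a" where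
  "cycle3 B i j k = B $$ (i, j) * B $$ (j, k) * B $$ (k, i)"

definition triples :: "nat \<Rightarrow> (nat \<times> nat \<times> nat) set" where
  "triples n = {(i, j, k). i < n \<and> j < n \<and> k < n \<and> distinct [i, j, k]}"

text \<open>Pairs are compared as unordered sets, so a single condition rules out both unspecified
  corners at every position of the cycle.\<close>

definition inner_triples :: "nat \<Rightarrow> (nat \<times> nat \<times> nat) set" where
  "inner_triples n =
     {(i, j, k) \<in> triples n. {0, n - 1} \<notin> {{i, j}, {j, k}, {k, i}}}"

lemma finite_triples: "finite (triples n)"
  by (rule finite_subset[of _ "{..<n} \<times> {..<n} \<times> {..<n}"]) (auto simp: triples_def)

lemma inner_triples_subset: "inner_triples n \<subseteq> triples n"
  by (auto simp: inner_triples_def)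

lemma inner_triples_nonempty:
  assumes "n \<ge> 4"
  shows "inner_triples n \<noteq> {}"
proof -
  \<comment> \<open>Since n \<ge> 4, the last index \<open>n - 1\<close> is at least 3 and does not
    occur in this triple.\<close>
  have "(0, 1, 2) \<in> inner_triples n"
    using assms by (auto simp: inner_triples_def triples_def doubleton_eq_iff)
  then show ?thesis by blast
qed

lemma setcompr3_eq_image: "{f i j k | i j k. (i, j, k) \<in> S} = (\<lambda>(i, j, k). f i j k) ` S"
  by force

lemma MT_eq: "MT n B = Max ((\<lambda>(i, j, k). cycle3 B i j k) ` triples n)"
  unfolding setcompr3_eq_image[of "cycle3 B", symmetric] MT_def by (simp add: triples_def cycle3_def conj_assoc)

lemma corner_completion_corner:
  assumes "n \<ge> 2"
  shows "corner_completion n A x $$ (0, n - 1) = x"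
    and "corner_completion n A x $$ (n - 1, 0) = 1 / x"
  using assms by (simp_all add: corner_completion_def)

lemma corner_completion_inner:
  assumes "i < n" "j < n" "{0, n - 1} \<noteq> {i, j}"
  shows "corner_completion n A x $$ (i, j) = the (A $$ (i, j))"
  using assms by (auto simp: corner_completion_def doubleton_eq_iff)

text \<open>Inner cycles never meet a corner, so \<open>x\<close> is arbitrary here. Both maxima
  thereby become maxima of the same function \<open>cycle3\<close> over nested index sets.\<close>

lemma MT_partial_eq:
  "MT_partial n A =
     Max ((\<lambda>(i, j, k). cycle3 (corner_completion n A x) i j k) ` inner_triples n)"
proof -
  have "{the (A $$ (i, j)) * the (A $$ (j, k)) * the (A $$ (k, i)) | i j k.
      i < n \<and> j < n \<and> k < n \<and> distinct [i, j, k] \<and> {0, n - 1} \<notin> {{i, j}, {j, k}, {k, i}}} =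
    (\<lambda>(i, j, k). the (A $$ (i, j)) * the (A $$ (j, k)) * the (A $$ (k, i))) ` inner_triples n"
    by (subst setcompr3_eq_image[symmetric]) (simp add: inner_triples_def triples_def conj_assoc)
  also have "\<dots> = (\<lambda>(i, j, k). cycle3 (corner_completion n A x) i j k) ` inner_triples n"
  proof (rule image_cong[OF refl], clarify)
    fix i j k assume "(i, j, k) \<in> inner_triples n"
    then have "i < n" "j < n" "k < n"
        "{0, n - 1} \<noteq> {i, j}" "{0, n - 1} \<noteq> {j, k}" "{0, n - 1} \<noteq> {k, i}"
      by (simp_all add: inner_triples_def triples_def)
    then show "the (A $$ (i, j)) * the (A $$ (j, k)) * the (A $$ (k, i)) =
        cycle3 (corner_completion n A x) i j k"
      by (simp add: cycle3_def corner_completion_inner)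
  qed
  finally show ?thesis unfolding MT_partial_def by simp
qed

lemma corner_paths_eq:
  "{the (A $$ (0, j)) * the (A $$ (j, n - 1)) | j. 0 < j \<and> j < n - 1} =
   (\<lambda>j. corner_completion n A x $$ (0, j) * corner_completion n A x $$ (j, n - 1)) ` {0<..<n - 1}"
  (is "_ = ?f ` _")
proof -
  have "?f j = the (A $$ (0, j)) * the (A $$ (j, n - 1))" if "0 < j" "j < n - 1" for j
    using that by (simp add: corner_completion_inner doubleton_eq_iff)
  then show ?thesis by force
qed

text \<open>The index \<open>l\<close> is the one different from both ends. The first three triples
  are the rotations of the cycle 0, l, n - 1; the last three are those of the reversed
  cycle.\<close>

lemma outer_triple_cases:
  assumes "(i, j, k) \<in> triples n" "(i, j, k) \<notin> inner_triples n"
  obtains l where "0 < l" "l < n - 1"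
    "(i, j, k) \<in> {(0, l, n - 1), (l, n - 1, 0), (n - 1, 0, l),
                  (0, n - 1, l), (n - 1, l, 0), (l, 0, n - 1)}"
proof -
  have "{0, n - 1} = {i, j} \<or> {0, n - 1} = {j, k} \<or> {0, n - 1} = {k, i}"
    using assms by (simp add: inner_triples_def)
  then consider "{0, n - 1} = {i, j}" | "{0, n - 1} = {j, k}" | "{0, n - 1} = {k, i}"
    by metis
  then show ?thesis
  proof cases
    case 1
    then show ?thesis using assms(1) that[of k] by (auto simp: triples_def doubleton_eq_iff)
  next
    case 2
    then show ?thesis using assms(1) that[of i] by (auto simp: triples_def doubleton_eq_iff)
  next
    case 3
    then show ?thesis using assms(1) that[of j] by (auto simp: triples_def doubleton_eq_iff)
  qed
qed

text \<open>By commutativity a cycle product is invariant under rotation, so the six orderings of an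
  outer triple yield only two values, one for each orientation.\<close>

lemma ball_triples_iff:
  fixes B :: "'a :: {ab_semigroup_mult, ord} mat"
  assumes "\<And>i j k. (i, j, k) \<in> inner_triples n \<Longrightarrow> cycle3 B i j k \<le> m"
  shows "(\<forall>(i, j, k)\<in>triples n. cycle3 B i j k \<le> m) \<longleftrightarrow>
    (\<forall>l\<in>{0<..<n - 1}. cycle3 B 0 l (n - 1) \<le> m \<and> cycle3 B 0 (n - 1) l \<le> m)"
proof
  assume "\<forall>(i, j, k)\<in>triples n. cycle3 B i j k \<le> m"
  moreover have "(0, l, n - 1) \<in> triples n" "(0, n - 1, l) \<in> triples n"
    if "l \<in> {0<..<n - 1}" for l
    using that by (auto simp: triples_def)
  ultimately show "\<forall>l\<in>{0<..<n - 1}. cycle3 B 0 l (n - 1) \<le> m \<and> cycle3 B 0 (n - 1) l \<le> m"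
    by fast
next
  assume R: "\<forall>l\<in>{0<..<n - 1}. cycle3 B 0 l (n - 1) \<le> m \<and> cycle3 B 0 (n - 1) l \<le> m"
  have "cycle3 B i j k \<le> m" if t: "(i, j, k) \<in> triples n" for i j k
  proof (cases "(i, j, k) \<in> inner_triples n")
    case False
    with t obtain l where l: "0 < l" "l < n - 1"
      and ijk: "(i, j, k) \<in> {(0, l, n - 1), (l, n - 1, 0), (n - 1, 0, l),
                  (0, n - 1, l), (n - 1, l, 0), (l, 0, n - 1)}"
      by (rule outer_triple_cases)
    have "cycle3 B i j k = cycle3 B 0 l (n - 1) \<or> cycle3 B i j k = cycle3 B 0 (n - 1) l"
      using ijk by (auto simp: cycle3_def mult_ac)
    then show ?thesis using R l by auto
  qed (rule assms)
  then show "\<forall>(i, j, k)\<in>triples n. cycle3 B i j k \<le> m" by blast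
qed

theorem theorem5p2:
  fixes n :: nat and A :: "real option mat" and x0 :: real
  assumes "n \<ge> 4"
    and "partial_reciprocal_mat n A"
    and "only_corners_unspecified n A"
    and "x0 > 0"
  shows "MT n (corner_completion n A x0) = MT_partial n A \<longleftrightarrow>
    1 / MT_partial n A * MaxS n A \<le> x0 \<and> x0 \<le> MT_partial n A * MinS n A"
proof -
  define B where "B = corner_completion n A x0"
  define s where "s j = B $$ (0, j) * B $$ (j, n - 1)" for j
  define m where "m = MT_partial n A"
  let ?c = "\<lambda>(i, j, k). cycle3 B i j k"
  let ?J = "{0<..<n - 1}"
  have "reciprocal_mat n B"
    unfolding B_def using assms by (intro reciprocal_corner_completion) auto
  then have pos: "B $$ (i, j) > 0" and recip: "B $$ (j, i) = 1 / B $$ (i, j)"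
    if "i < n" "j < n" for i j
    using that unfolding reciprocal_mat_def by blast+
  have corner: "B $$ (0, n - 1) = x0" "B $$ (n - 1, 0) = 1 / x0"
    unfolding B_def using assms(1) corner_completion_corner[of n A x0] by simp_all
  have m: "m = Max (?c ` inner_triples n)"
    unfolding m_def B_def by (rule MT_partial_eq)
  have fin: "finite (?c ` inner_triples n)"
    using finite_triples inner_triples_subset by (metis finite_imageI finite_subset)
  have ne: "?c ` inner_triples n \<noteq> {}"
    using inner_triples_nonempty[OF assms(1)] by simp
  have "1 \<in> ?J" using assms(1) by simp
  then have J: "finite ?J" "?J \<noteq> {}" by (simp, blast)
  have "m > 0"
  proof -
    have "?c ` inner_triples n \<subseteq> {0<..}"
      by (auto simp: inner_triples_def triples_def cycle3_def pos)
    with Max_in[OF fin ne] show ?thesis unfolding m by blast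
  qed
  have s_pos: "s j > 0" if "j \<in> ?J" for j
    using that unfolding s_def by (intro mult_pos_pos pos) auto
  \<comment> \<open>The path from 0 through \<open>j\<close> to \<open>n - 1\<close> is closed by
    the corner entry \<open>1 / x0\<close>.\<close>
  have cycle_out: "cycle3 B 0 j (n - 1) = s j / x0" for j
    unfolding cycle3_def s_def corner by simp
  \<comment> \<open>Reversing a cycle inverts each factor, so this product is the reciprocal of the
    previous one.\<close>
  have cycle_back: "cycle3 B 0 (n - 1) j = x0 / s j" if "j \<in> ?J" for j
  proof -
    have "B $$ (n - 1, j) = 1 / B $$ (j, n - 1)" "B $$ (j, 0) = 1 / B $$ (0, j)"
      using that by (auto intro!: recip simp del: One_nat_def)
    then show ?thesis unfolding cycle3_def s_def corner by simp
  qed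
  have "MT n B = m \<longleftrightarrow> (\<forall>t\<in>?c ` triples n. t \<le> m)"
    unfolding m MT_eq using finite_triples inner_triples_subset ne
    by (intro Max_superset_eq_iff) blast+
  also have "\<dots> \<longleftrightarrow> (\<forall>(i, j, k)\<in>triples n. cycle3 B i j k \<le> m)"
    by auto
  also have "\<dots> \<longleftrightarrow> (\<forall>j\<in>?J. cycle3 B 0 j (n - 1) \<le> m \<and> cycle3 B 0 (n - 1) j \<le> m)"
  proof (rule ball_triples_iff)
    fix i j k assume "(i, j, k) \<in> inner_triples n"
    then show "cycle3 B i j k \<le> m"
      unfolding m using fin by (intro Max_ge) force+
  qed
  \<comment> \<open>Isolating \<open>s j\<close> in both inequalities leaves bounds independent of
    \<open>j\<close>, so the first family is a condition on the maximum of \<open>s\<close> over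
    \<open>?J\<close> and the second on its minimum.\<close>
  also have "\<dots> \<longleftrightarrow> (\<forall>j\<in>?J. s j \<le> m * x0) \<and> (\<forall>j\<in>?J. x0 / m \<le> s j)"
    unfolding ball_conj_distrib[symmetric]
  proof (rule ball_cong[OF refl])
    fix j assume j: "j \<in> ?J"
    show "cycle3 B 0 j (n - 1) \<le> m \<and> cycle3 B 0 (n - 1) j \<le> m \<longleftrightarrow>
        s j \<le> m * x0 \<and> x0 / m \<le> s j"
      unfolding cycle_out cycle_back[OF j]
      using \<open>m > 0\<close> assms(4) s_pos[OF j] by (simp add: field_simps)
  qed
  also have "(\<forall>j\<in>?J. s j \<le> m * x0) \<longleftrightarrow> Max (s ` ?J) \<le> m * x0"
    using J by simp
  also have "(\<forall>j\<in>?J. x0 / m \<le> s j) \<longleftrightarrow> x0 / m \<le> Min (s ` ?J)"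
    using J by simp
  also have "s ` ?J = {the (A $$ (0, j)) * the (A $$ (j, n - 1)) | j. 0 < j \<and> j < n - 1}"
    unfolding corner_paths_eq[of A n x0] s_def B_def ..
  finally have "MT n B = m \<longleftrightarrow> MaxS n A \<le> m * x0 \<and> x0 / m \<le> MinS n A"
    unfolding MaxS_def MinS_def .
  then show ?thesis
    using \<open>m > 0\<close> unfolding B_def m_def by (simp add: field_simps)
qed

end
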